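(* Suppose $\mathcal{C}\subset\mathbb{R}^k$ is a convex set of the form $$\mathcal{C}=\{\mathbf{c}\in\mathbb{R}^k \mid \mathbf{c}\ge\mathbf{0},\ \mathbf{g}+\mathbf{F}\mathbf{c}\in\mathcal{K}\}$$ for a closed convex cone $\mathcal{K}\subset\mathbb{R}^\ell$ and $\mathbf{g}\in\mathbb{R}^\ell$, $\mathbf{F}\in\mathbb{R}^{\ell\times k}$, and that for $i=1,\dots,k$ the set $\mathcal{Q}^{(i)}\subset\mathbb{R}^n$ is of the form $$\mathcal{Q}^{(i)}=\{\mathbf{q}^{(i)}\in\mathbb{R}^n \mid \mathbf{h}^{(i)}+\mathbf{M}^{(i)}\mathbf{q}^{(i)}\in\mathcal{F}^{(i)}\}$$ for closed convex cones $\mathcal{F}^{(i)}\subset\mathbb{R}^m$ and $\mathbf{h}^{(i)}\in\mathbb{R}^m$, $\mathbf{M}^{(i)}\in\mathbb{R}^{m\times n}$. Assume further that there exists a point in $\mathcal{C}$ satisfying the conic and nonnegativity constraints strictly, and that for each $i$ there exists a point of $\mathcal{Q}^{(i)}$ satisfying the corresponding conic constraint strictly. Let $t\in\mathbb{R}$. Then $\mathbf{x}\in\mathbb{R}^n$ satisfies $$\sup_{\mathbf{c}\in\mathcal{C},\ \mathbf{q}^{(i)}\in\mathcal{Q}^{(i)}\,(i=1,\dots,k)}\ \sum_{i=1}^k c_i\exp\big({\mathbf{q}^{(i)}}'\mathbf{x}\big)\le t$$ if and only if there exist $\boldsymbol{\zeta}\in\mathbb{R}^\ell$ and $\boldsymbol{\theta}^{(i)}\in\mathbb{R}^m$,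 $i=1,\dots,k$, such that $$\mathbf{g}'\boldsymbol{\zeta}\le t,\qquad \boldsymbol{\zeta}\in\mathcal{K}^\star,$$ $${\mathbf{M}^{(i)}}'\boldsymbol{\theta}^{(i)}+\mathbf{x}=\mathbf{0},\quad \exp\big({\mathbf{h}^{(i)}}'\boldsymbol{\theta}^{(i)}\big)+[\mathbf{F}'\boldsymbol{\zeta}]_i\le 0,\quad \boldsymbol{\theta}^{(i)}\in{\mathcal{F}^{(i)}}^\star,\quad i=1,\dots,k.$$
   Context: Primes denote transposes; inequalities between vectors are elementwise. For a convex cone $\mathcal{K}\subseteq\mathbb{R}^\ell$ the dual cone is $\mathcal{K}^\star=\{\boldsymbol{\nu} \mid \mathbf{x}'\boldsymbol{\nu}\ge0\ \forall\,\mathbf{x}\in\mathcal{K}\}$. A point satisfies a conic constraint $\mathbf{a}\in\mathcal{K}$ strictly if $\mathbf{a}$ lies in the interior of $\mathcal{K}$, and satisfies $\mathbf{c}\ge\mathbf{0}$ strictly if all entries of $\mathbf{c}$ are positive. *)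

theory Defs
  imports "HOL-Analysis.Analysis"
begin

definition dual_cone :: "'a::real_inner set \<Rightarrow> 'a set"
  where "dual_cone K = {\<nu>. \<forall>x\<in>K. 0 \<le> x \<bullet> \<nu>}"

end

theory Submission
  imports Defs
begin

text \<open>Since \<open>c \<ge> 0\<close>, the supremum over the \<open>q\<^sup>(\<^sup>i\<^sup>)\<close> replaces each exponent by
  \<open>s\<^sub>i = sup {q \<bullet> x | q \<in> Q\<^sup>(\<^sup>i\<^sup>)}\<close>, which is finite because some \<open>c \<in> C\<close> is positive. Strong conic
  duality turns each \<open>s\<^sub>i\<close> into a minimum attained at some \<open>\<theta>\<^sup>(\<^sup>i\<^sup>)\<close>, and then, applied to the
  product of \<open>K\<close> and the nonnegative orthant, turns the remaining problem, linear in \<open>c\<close>, into a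
  minimum attained at some \<open>\<zeta>\<close>.\<close>

text \<open>A hyperplane separates the constraint-objective pairs from \<open>K\<close> times the
  positive reals. The Slater point \<open>q0\<close> makes its normal non-vertical, that is
  \<open>\<mu> > 0\<close>, and \<open>\<theta>\<close> divided by \<open>\<mu>\<close> is the
  multiplier sought.\<close>

lemma conic_strong_duality:
  fixes A :: "'a::euclidean_space \<Rightarrow> 'b::euclidean_space"
  assumes A: "linear A" and K: "convex K" "cone K"
    and slater: "b + A q0 \<in> interior K"
    and bound: "\<And>q. b + A q \<in> K \<Longrightarrow> q \<bullet> x \<le> s"
  obtains \<theta> where "\<theta> \<in> dual_cone K" "\<And>q. A q \<bullet> \<theta> + q \<bullet> x = 0" "b \<bullet> \<theta> \<le> s"
proof -
  \<comment> \<open>A common point of \<open>S1\<close> and \<open>S2\<close> would be a feasible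
    \<open>q\<close> with \<open>q \<bullet> x > s\<close>, which \<open>bound\<close>
    excludes.\<close>
  define S1 where "S1 = (\<lambda>q. (b + A q, q \<bullet> x - s)) ` UNIV"
  define S2 where "S2 = K \<times> {0::real<..}"
  have y0: "b + A q0 \<in> K"
    using slater interior_subset by blast
  then have zero: "0 \<in> K"
    using K(2) unfolding cone_def by (metis order_refl scaleR_zero_left)
  have "linear (\<lambda>q. (A q, q \<bullet> x))"
    using A by (auto simp: linear_iff inner_add_left)
  then have "convex ((+) (b, -s) ` (\<lambda>q. (A q, q \<bullet> x)) ` UNIV)"
    by (intro convex_translation convex_linear_image) auto
  also have "(+) (b, -s) ` (\<lambda>q. (A q, q \<bullet> x)) ` UNIV = S1"
    by (auto simp: S1_def image_image)
  finally have "convex S1" .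
  moreover have "convex S2"
    unfolding S2_def using K(1) by (intro convex_Times) auto
  moreover have "S1 \<noteq> {}" "S2 \<noteq> {}"
    using y0 by (auto simp: S1_def S2_def intro: gt_ex)
  moreover have "S1 \<inter> S2 = {}"
    using bound by (force simp: S1_def S2_def)
  ultimately obtain a \<beta> where a0: "a \<noteq> 0" and a1: "\<forall>p\<in>S1. a \<bullet> p \<le> \<beta>" and a2: "\<forall>p\<in>S2. \<beta> \<le> a \<bullet> p"
    using separating_hyperplane_sets by metis
  obtain \<theta> \<mu> where a: "a = (\<theta>, \<mu>)"
    by fastforce
  have upper: "(b + A q) \<bullet> \<theta> + \<mu> * (q \<bullet> x - s) \<le> \<beta>" for q
    using a1 by (auto simp: S1_def a inner_commute)
  have lower: "\<beta> \<le> y \<bullet> \<theta> + \<mu> * r" if "y \<in> K" "r > 0" for y r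
    using a2 that by (auto simp: S2_def a inner_commute[of \<theta>] mult.commute[of \<mu>])
  \<comment> \<open>\<open>S2\<close> is invariant under positive scaling, so its lower bound
    \<open>\<beta>\<close> holds along whole rays; a negative value could then be scaled below
    \<open>\<beta>\<close>.\<close>
  have scaled: "\<beta> \<le> d * (y \<bullet> \<theta> + \<mu> * r)" if "y \<in> K" "r > 0" "d > 0" for y r d
    using lower[of "d *\<^sub>R y" "d * r"] that K(2) by (auto simp: cone_def algebra_simps)
  have nonneg: "0 \<le> y \<bullet> \<theta> + \<mu> * r" if y: "y \<in> K" and r: "r > 0" for y r
  proof (rule ccontr)
    let ?z = "y \<bullet> \<theta> + \<mu> * r"
    let ?d = "(\<bar>\<beta>\<bar> + 1) / \<bar>?z\<bar>"
    assume neg: "\<not> 0 \<le> ?z"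
    then have "\<beta> \<le> ?d * ?z"
      by (intro scaled y r divide_pos_pos) auto
    also have "?d * ?z = - (\<bar>\<beta>\<bar> + 1)"
    proof -
      have "w < 0 \<Longrightarrow> a / \<bar>w\<bar> * w = - a" for a w :: real
        by simp
      with neg show ?thesis
        by (simp only: not_le)
    qed
    finally show False
      by linarith
  qed
  have mu: "0 \<le> \<mu>"
    using nonneg[OF zero, of 1] by simp
  \<comment> \<open>The origin is only a limit point of \<open>S2\<close>, so it is approached by
    \<open>(0, r)\<close> with small \<open>r > 0\<close>. The denominator \<open>\<mu> + 1\<close>
    covers \<open>\<mu> = 0\<close> as well.\<close>
  have beta: "\<beta> \<le> 0"
  proof (rule field_le_epsilon)
    fix e :: real assume "e > 0"
    then have "\<beta> \<le> e / (\<mu> + 1) * \<mu>"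
      using lower[OF zero, of "e / (\<mu> + 1)"] mu by (simp add: mult.commute)
    also have "\<dots> \<le> 0 + e"
      using mu \<open>e > 0\<close> by (simp add: field_simps)
    finally show "\<beta> \<le> 0 + e" .
  qed
  have dual: "0 \<le> y \<bullet> \<theta>" if "y \<in> K" for y
  proof (rule field_le_epsilon)
    fix e :: real assume "e > 0"
    then have "0 \<le> y \<bullet> \<theta> + e / (\<mu> + 1) * \<mu>"
      using nonneg[OF that, of "e / (\<mu> + 1)"] mu by (simp add: mult.commute)
    also have "\<dots> \<le> y \<bullet> \<theta> + e"
      using mu \<open>e > 0\<close> by (simp add: field_simps)
    finally show "0 \<le> y \<bullet> \<theta> + e" .
  qed
  \<comment> \<open>An affine function bounded above on the whole space has zero linear part:
    scaling \<open>q\<close> by \<open>?d\<close> would overshoot the bound by exactly 1.\<close>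
  have stationary: "A q \<bullet> \<theta> + \<mu> * (q \<bullet> x) = 0" for q
  proof (rule ccontr)
    let ?z = "A q \<bullet> \<theta> + \<mu> * (q \<bullet> x)"
    let ?d = "(\<beta> - b \<bullet> \<theta> + \<mu> * s + 1) / ?z"
    assume "?z \<noteq> 0"
    then have "?d * ?z = \<beta> - b \<bullet> \<theta> + \<mu> * s + 1"
      by simp
    moreover have "b \<bullet> \<theta> + d * ?z - \<mu> * s \<le> \<beta>" for d
      using upper[of "d *\<^sub>R q"] linear_scale[OF A, of d q]
      by (simp add: inner_add_left algebra_simps)
    moreover from this[of ?d] have "b \<bullet> \<theta> + ?d * ?z - \<mu> * s \<le> \<beta>" .
    ultimately show False
      by linarith
  qed
  have value_le: "b \<bullet> \<theta> \<le> \<mu> * s"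
    using upper[of 0] beta linear_0[OF A] by simp
  \<comment> \<open>Otherwise \<open>\<theta>\<close> is nonzero, nonnegative on \<open>K\<close>,
    and at most 0 at an interior point of \<open>K\<close>. A step of length \<open>e\<close> from
    that point against \<open>\<theta>\<close> stays in \<open>K\<close> but makes the product
    negative.\<close>
  have "\<mu> \<noteq> 0"
  proof
    assume m0: "\<mu> = 0"
    then have t0: "\<theta> \<noteq> 0"
      using a0 a by (auto simp: zero_prod_def)
    have le0: "(b + A q0) \<bullet> \<theta> \<le> 0"
      using stationary[of q0] value_le m0 by (simp add: inner_add_left)
    obtain e where e: "e > 0" "cball (b + A q0) e \<subseteq> K"
      using slater mem_interior_cball by blast
    have "b + A q0 - (e / norm \<theta>) *\<^sub>R \<theta> \<in> K"
      using e t0 by (intro subsetD[OF e(2)]) (auto simp: dist_norm)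
    then have "0 \<le> (b + A q0 - (e / norm \<theta>) *\<^sub>R \<theta>) \<bullet> \<theta>"
      by (rule dual)
    also have "\<dots> = (b + A q0) \<bullet> \<theta> - e / norm \<theta> * (\<theta> \<bullet> \<theta>)"
      by (simp add: inner_diff_left)
    also have "\<dots> < 0"
      using le0 e(1) t0 by (smt (verit) divide_pos_pos inner_gt_zero_iff mult_pos_pos zero_less_norm_iff)
    finally show False
      by simp
  qed
  with mu have mu_pos: "\<mu> > 0"
    by simp
  show thesis
  proof
    show "(1 / \<mu>) *\<^sub>R \<theta> \<in> dual_cone K"
      using dual mu_pos by (auto simp: dual_cone_def)
    show "A q \<bullet> ((1 / \<mu>) *\<^sub>R \<theta>) + q \<bullet> x = 0" for q
      using stationary[of q] mu_pos by (simp add: field_simps)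
    show "b \<bullet> ((1 / \<mu>) *\<^sub>R \<theta>) \<le> s"
      using value_le mu_pos by (simp add: field_simps)
  qed
qed

lemma transpose_matrix_inner:
  fixes A :: "real ^ 'n ^ 'm"
  shows "(A *v q) \<bullet> \<theta> = q \<bullet> (transpose A *v \<theta>)"
  by (metis dot_lmul_matrix inner_commute transpose_matrix_vector)

text \<open>Stationarity for every \<open>q\<close> says that
  \<open>transpose A *v \<theta> + x\<close> is orthogonal to all vectors, itself included.\<close>

lemma matrix_conic_strong_duality:
  fixes A :: "real ^ 'n ^ 'm"
  assumes "convex K" "cone K" "b + A *v q0 \<in> interior K"
    and "\<And>q. b + A *v q \<in> K \<Longrightarrow> q \<bullet> x \<le> s"
  obtains \<theta> where "\<theta> \<in> dual_cone K" "transpose A *v \<theta> + x = 0" "b \<bullet> \<theta> \<le> s"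
proof -
  obtain \<theta> where \<theta>: "\<theta> \<in> dual_cone K" "\<And>q. (A *v q) \<bullet> \<theta> + q \<bullet> x = 0" "b \<bullet> \<theta> \<le> s"
    using conic_strong_duality[OF matrix_vector_mul_linear assms] by metis
  have "q \<bullet> (transpose A *v \<theta> + x) = 0" for q
    using \<theta>(2)[of q] by (simp add: transpose_matrix_inner inner_add_right)
  then have "transpose A *v \<theta> + x = 0"
    by (metis inner_eq_zero_iff)
  with \<theta> show thesis
    using that by blast
qed

text \<open>Both constraints become one conic constraint on \<open>(g + F *v c, c)\<close>. The
  multiplier \<open>\<eta>\<close> of \<open>0 \<le> c\<close> is the slack that relaxes the dual
  equation to an inequality.\<close>

lemma nonneg_conic_strong_duality:
  fixes F :: "real ^ 'k ^ 'l"
  assumes K: "convex K" "cone K"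
    and slater: "\<And>i. 0 < c0 $ i" "g + F *v c0 \<in> interior K"
    and bound: "\<And>c. 0 \<le> c \<Longrightarrow> g + F *v c \<in> K \<Longrightarrow> c \<bullet> e \<le> t"
  obtains \<zeta> where "\<zeta> \<in> dual_cone K" "\<And>i. e $ i + (transpose F *v \<zeta>) $ i \<le> 0" "g \<bullet> \<zeta> \<le> t"
proof -
  let ?P = "{c :: real ^ 'k. 0 \<le> c}"
  have "open {c :: real ^ 'k. \<forall>i. 0 < c $ i}"
    unfolding Collect_all_eq
    by (intro open_INT ballI open_Collect_less continuous_intros) simp
  moreover have "{c :: real ^ 'k. \<forall>i. 0 < c $ i} \<subseteq> ?P"
    by (auto simp: less_eq_vec_def less_imp_le)
  ultimately have "c0 \<in> interior ?P"
    using slater(1) by (auto intro: interiorI)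
  then have int: "(g, 0) + (F *v c0, c0) \<in> interior (K \<times> ?P)"
    using slater(2) by (simp add: interior_Times)
  have lin: "linear (\<lambda>c. (F *v c, c))"
    by (auto simp: linear_iff matrix_vector_right_distrib matrix_vector_mult_scaleR)
  have conv: "convex (K \<times> ?P)"
    using K(1) by (intro convex_Times) (auto simp: convex_def less_eq_vec_def)
  have cone: "cone (K \<times> ?P)"
    using K(2) by (auto simp: cone_def less_eq_vec_def)
  obtain p where p: "p \<in> dual_cone (K \<times> ?P)" "\<And>c. (F *v c, c) \<bullet> p + c \<bullet> e = 0" "(g, 0) \<bullet> p \<le> t"
    using conic_strong_duality[OF lin conv cone int, of e t] bound by auto
  obtain \<zeta> \<eta> where p_eq: "p = (\<zeta>, \<eta>)"
    by fastforce
  have zero: "0 \<in> K"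
    using slater(2) interior_subset K(2) unfolding cone_def
    by (metis in_mono order_refl scaleR_zero_left)
  have dual: "0 \<le> y \<bullet> \<zeta> + c \<bullet> \<eta>" if "y \<in> K" "0 \<le> c" for y c
    using p(1) that by (auto simp: dual_cone_def p_eq)
  show thesis
  proof
    show "\<zeta> \<in> dual_cone K"
      using dual[of _ 0] by (auto simp: dual_cone_def)
    show "g \<bullet> \<zeta> \<le> t"
      using p(3) by (simp add: p_eq)
    \<comment> \<open>Testing with the unit vector \<open>axis i 1\<close> extracts the
      \<open>i\<close>-th coordinates of dual feasibility and stationarity.\<close>
    fix i
    have "0 \<le> (axis i 1 :: real ^ 'k)"
      by (simp add: less_eq_vec_def axis_def)
    then have "0 \<le> \<eta> $ i"
      using dual[OF zero, of "axis i 1"] by (simp add: inner_axis')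
    moreover have "(transpose F *v \<zeta>) $ i + \<eta> $ i + e $ i = 0"
      using p(2)[of "axis i 1"] by (simp add: p_eq transpose_matrix_inner inner_axis')
    ultimately show "e $ i + (transpose F *v \<zeta>) $ i \<le> 0"
      by linarith
  qed
qed

theorem proposition3:
  fixes C :: "(real ^ 'k) set"
    and K :: "(real ^ 'l) set"
    and g :: "real ^ 'l"
    and F :: "real ^ 'k ^ 'l"
    and Q :: "'k \<Rightarrow> (real ^ 'n) set"
    and FF :: "'k \<Rightarrow> (real ^ 'm) set"
    and h :: "'k \<Rightarrow> real ^ 'm"
    and M :: "'k \<Rightarrow> real ^ 'n ^ 'm"
    and t :: real
    and x :: "real ^ 'n"
  assumes "convex C"
    and "C = {c. 0 \<le> c \<and> g + F *v c \<in> K}"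
    and "closed K" and "convex K" and "cone K"
    and "\<And>i. Q i = {q. h i + M i *v q \<in> FF i}"
    and "\<And>i. closed (FF i)" and "\<And>i. convex (FF i)" and "\<And>i. cone (FF i)"
    and "\<exists>c\<in>C. (\<forall>i. 0 < c $ i) \<and> g + F *v c \<in> interior K"
    and "\<And>i. \<exists>q\<in>Q i. h i + M i *v q \<in> interior (FF i)"
  shows "(SUP (c, q) \<in> {(c, q). c \<in> C \<and> (\<forall>i. q i \<in> Q i)}.
            ereal (\<Sum>i\<in>UNIV. c $ i * exp (q i \<bullet> x))) \<le> ereal t
    \<longleftrightarrow> (\<exists>\<zeta> \<theta>. g \<bullet> \<zeta> \<le> t \<and> \<zeta> \<in> dual_cone K \<and>
          (\<forall>i. transpose (M i) *v \<theta> i + x = 0 \<and>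
               exp (h i \<bullet> \<theta> i) + (transpose F *v \<zeta>) $ i \<le> 0 \<and>
               \<theta> i \<in> dual_cone (FF i)))"
  (is "?sup \<le> ereal t \<longleftrightarrow> ?rhs")
proof -
  note C = assms(2) and Q = assms(6)
  let ?obj = "\<lambda>c q. \<Sum>i\<in>UNIV. c $ i * exp (q i \<bullet> x)"
  have "?sup \<le> ereal t \<longleftrightarrow> (\<forall>c q. c \<in> C \<longrightarrow> (\<forall>i. q i \<in> Q i) \<longrightarrow> ?obj c q \<le> t)"
    by (auto simp: SUP_le_iff)
  also have "\<dots> \<longleftrightarrow> ?rhs"
  proof
    assume "?rhs"
    then obtain \<zeta> \<theta> where z: "g \<bullet> \<zeta> \<le> t" "\<zeta> \<in> dual_cone K"
      and th: "\<And>i. transpose (M i) *v \<theta> i + x = 0"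
        "\<And>i. exp (h i \<bullet> \<theta> i) + (transpose F *v \<zeta>) $ i \<le> 0"
        "\<And>i. \<theta> i \<in> dual_cone (FF i)"
      by blast
    show "\<forall>c q. c \<in> C \<longrightarrow> (\<forall>i. q i \<in> Q i) \<longrightarrow> ?obj c q \<le> t"
    proof (intro allI impI)
      fix c q assume c: "c \<in> C" and q: "\<forall>i. q i \<in> Q i"
      \<comment> \<open>Weak duality, summand by summand: \<open>h i \<bullet> \<theta> i\<close>
        dominates the exponent, and \<open>c $ i \<ge> 0\<close> preserves the order.\<close>
      have "c $ i * exp (q i \<bullet> x) \<le> c $ i * - ((transpose F *v \<zeta>) $ i)" for i
      proof (rule mult_left_mono)
        have "0 \<le> (h i + M i *v q i) \<bullet> \<theta> i"
          using th(3)[of i] q by (auto simp: Q dual_cone_def)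
        moreover have "x = - (transpose (M i) *v \<theta> i)"
          using th(1)[of i] by (simp add: add_eq_0_iff)
        ultimately have "q i \<bullet> x \<le> h i \<bullet> \<theta> i"
          by (simp add: inner_add_left transpose_matrix_inner)
        then have "exp (q i \<bullet> x) \<le> exp (h i \<bullet> \<theta> i)"
          by simp
        then show "exp (q i \<bullet> x) \<le> - ((transpose F *v \<zeta>) $ i)"
          using th(2)[of i] by linarith
        show "0 \<le> c $ i"
          using c by (simp add: C less_eq_vec_def)
      qed
      then have "?obj c q \<le> (\<Sum>i\<in>UNIV. c $ i * - ((transpose F *v \<zeta>) $ i))"
        by (rule sum_mono)
      also have "\<dots> = - (c \<bullet> (transpose F *v \<zeta>))"
        by (simp add: inner_vec_def sum_negf)
      also have "\<dots> = - ((F *v c) \<bullet> \<zeta>)"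
        by (simp add: transpose_matrix_inner)
      also have "\<dots> \<le> g \<bullet> \<zeta>"
        using z(2) c by (auto simp: C dual_cone_def inner_add_left dest!: bspec[where x="g + F *v c"])
      finally show "?obj c q \<le> t"
        using z(1) by simp
    qed
  next
    assume "\<forall>c q. c \<in> C \<longrightarrow> (\<forall>i. q i \<in> Q i) \<longrightarrow> ?obj c q \<le> t"
    then have obj: "?obj c q \<le> t" if "c \<in> C" "\<And>i. q i \<in> Q i" for c q
      using that by blast
    obtain c0 where c0: "c0 \<in> C" "\<And>i. 0 < c0 $ i" "g + F *v c0 \<in> interior K"
      using assms(10) by blast
    obtain q0 where q0: "\<And>i. q0 i \<in> Q i" "\<And>i. h i + M i *v q0 i \<in> interior (FF i)"
      using assms(11) by metis
    define s where "s i = (SUP q\<in>Q i. q \<bullet> x)" for i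
    \<comment> \<open>Only the \<open>i\<close>-th block of \<open>q0\<close> is varied. The other
      summands are nonnegative, so the \<open>i\<close>-th alone is at most \<open>t\<close>, and
      \<open>c0 $ i > 0\<close> allows division.\<close>
    have bdd: "bdd_above ((\<lambda>q. q \<bullet> x) ` Q i)" for i
    proof (rule bdd_aboveI2)
      fix q assume q: "q \<in> Q i"
      let ?q = "q0(i := q)"
      have "c0 $ i * exp (?q i \<bullet> x) \<le> ?obj c0 ?q"
        using c0(2) by (intro member_le_sum) (auto simp: less_imp_le)
      also have "\<dots> \<le> t"
        using q q0(1) by (intro obj c0) auto
      finally have "exp (q \<bullet> x) \<le> t / c0 $ i"
        using c0(2)[of i] by (simp add: field_simps)
      then show "q \<bullet> x \<le> ln (t / c0 $ i)"
        by (metis exp_gt_zero ln_exp ln_mono)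
    qed
    have le_s: "q \<bullet> x \<le> s i" if "q \<in> Q i" for q i
      unfolding s_def using bdd that by (rule cSUP_upper2) simp_all
    have "\<exists>\<theta>. \<theta> \<in> dual_cone (FF i) \<and> transpose (M i) *v \<theta> + x = 0 \<and> h i \<bullet> \<theta> \<le> s i" for i
      using matrix_conic_strong_duality[OF assms(8,9) q0(2), of i x "s i"] le_s[of _ i] by (auto simp: Q)
    then obtain \<theta> where th: "\<And>i. \<theta> i \<in> dual_cone (FF i)"
      "\<And>i. transpose (M i) *v \<theta> i + x = 0" "\<And>i. h i \<bullet> \<theta> i \<le> s i"
      by metis
    \<comment> \<open>The suprema \<open>s i\<close> may not be attained. Choosing every
      \<open>q i\<close> within \<open>\<epsilon>\<close> of its supremum costs one common factor
      \<open>exp (- \<epsilon>)\<close>, which tends to 1.\<close>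
    have lin: "c \<bullet> (\<chi> i. exp (s i)) \<le> t" if c: "c \<in> C" for c
    proof -
      let ?S = "\<Sum>i\<in>UNIV. c $ i * exp (s i)"
      have "exp (- \<epsilon>) * ?S \<le> t" if "\<epsilon> > 0" for \<epsilon>
      proof -
        have "\<exists>q\<in>Q i. s i - \<epsilon> < q \<bullet> x" for i
          using less_cSUP_iff[OF _ bdd[of i], of "s i - \<epsilon>"] q0(1)[of i] that by (auto simp: s_def)
        then obtain q where q: "\<And>i. q i \<in> Q i" "\<And>i. s i - \<epsilon> < q i \<bullet> x"
          by metis
        have "exp (- \<epsilon>) * ?S = (\<Sum>i\<in>UNIV. c $ i * exp (s i - \<epsilon>))"
          by (simp add: sum_distrib_left exp_diff exp_minus field_simps)
        also have "\<dots> \<le> ?obj c q"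
          using c q(2) by (intro sum_mono mult_left_mono) (auto simp: C less_eq_vec_def less_imp_le)
        also have "\<dots> \<le> t"
          using c q(1) by (rule obj)
        finally show ?thesis .
      qed
      then have ev: "\<forall>\<^sub>F \<epsilon> in at_right 0. exp (- \<epsilon>) * ?S \<le> t"
        by (auto simp: eventually_at_right_less intro: eventually_mono[OF eventually_at_right_less])
      have "((\<lambda>\<epsilon>::real. exp (- \<epsilon>) * ?S) \<longlongrightarrow> exp (- 0) * ?S) (at_right 0)"
        by (intro tendsto_intros)
      then have "exp (- 0) * ?S \<le> t"
        using ev by (rule tendsto_upperbound) simp
      then show ?thesis
        by (simp add: inner_vec_def)
    qed
    obtain \<zeta> where z: "\<zeta> \<in> dual_cone K" "g \<bullet> \<zeta> \<le> t"
      "\<And>i. (\<chi> i. exp (s i)) $ i + (transpose F *v \<zeta>) $ i \<le> 0"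
      using nonneg_conic_strong_duality[OF assms(4,5) c0(2,3), of "\<chi> i. exp (s i)" t] lin
      unfolding C by blast
    \<comment> \<open>The two dualities combine: \<open>h i \<bullet> \<theta> i \<le> s i\<close>,
      and \<open>exp\<close> is monotone.\<close>
    have "exp (h i \<bullet> \<theta> i) + (transpose F *v \<zeta>) $ i \<le> 0" for i
      using z(3)[of i] th(3)[of i] exp_le_cancel_iff[of "h i \<bullet> \<theta> i" "s i"]
      unfolding vec_lambda_beta by linarith
    then show ?rhs
      using z(1,2) th(1,2) by blast
  qed
  finally show ?thesis .
qed

end
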